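(* Let $(\Gamma,v_0)$ be a pointed graph. For every $k\in I(\Gamma)$, the operator $P_k$ is a bounded operator on $\ell^2(H(\Gamma))$. Moreover, with $$c_k=\sup_{j\in I(\Gamma)}\ \sum_{i\in \mathrm{Supp}^j(k)}(p_{k,i}^j)^2,\qquad d_k=\sup_{i\in I(\Gamma)}|\mathrm{Supp}_i(k)|,$$ the operator norm of $P_k$ satisfies $$1\leq\|P_k\|\leq\sqrt{c_kd_k}.$$
   Context: Graphs: $\Gamma$ is a graph with vertex set $V$, $d$ is the shortest-path distance, $v_0\in V$ is a fixed base point, and $(\Gamma,v_0)$ is called a pointed graph. For $v\in V$ put $|v|=d(v_0,v)$. For $w\in V$ and $n\in\mathbb{N}_0=\{0,1,2,\dots\}$ put $S_n(w)=\{w'\in V: d(w,w')=n\}$. Put $I(\Gamma)=I(\Gamma,v_0)=\{n\in\mathbb{N}_0: |v|=n \text{ for some } v\in V\}$ and $M(\Gamma)=\sup I(\Gamma)$. $|A|$ denotes the cardinality of a set $A$. Standing assumptions on every graph: (i) simple, connected and locally finite; (ii) at most countably many vertices; (iii) if $\Gamma$ is finite, $S_{M(\Gamma)}(v)\neq\varnothing$ for every vertex $v$. (Consequently $S_j(v)\ne\varnothing$ for all $v\in V$, $j\in I(\Gamma)$.) For $i,j,k\in I(\Gamma)$ put $$p_{i,j}^k=\frac{1}{|S_i(v_0)|}\sum_{v\in S_i(v_0)}\frac{|S_j(v)\cap S_k(v_0)|}{|S_j(v)|}.$$ $\ell^2(H(\Gamma))$ denotes the Hilbert space of square-summable complex sequences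 $\xi=(\xi_n)_{n\in I(\Gamma)}$. For $k\in I(\Gamma)$, the operator $P_k$ on $\ell^2(H(\Gamma))$ (the action on row vectors of the transition matrix $(p_{k,i}^j)_{i,j\in I(\Gamma)}$) is given by $P_k(\xi)_n=\sum_{l\in I(\Gamma)}p_{k,l}^n\xi_l$ for those $\xi=(\xi_n)\in\ell^2(H(\Gamma))$ with $\sum_{n\in I(\Gamma)}\left|\sum_{l\in I(\Gamma)}p_{k,l}^n\xi_l\right|^2<\infty$. (For each fixed $k,n$ only finitely many $p_{k,l}^n$ are nonzero. Boundedness on $\ell^2(H(\Gamma))$ means that $P_k$ is defined on all of $\ell^2(H(\Gamma))$ and bounded.) Supports: for $i,j,k\in I(\Gamma)$, $\mathrm{Supp}_i(k)=\{j\in I(\Gamma): p_{k,i}^j\neq0\}$ and $\mathrm{Supp}^j(k)=\{i\in I(\Gamma): p_{k,i}^j\neq0\}$. *)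

theory Defs
  imports
    "Graph_Theory.Pair_Digraph"
    "Graph_Theory.Digraph_Component"
    "Graph_Theory.Shortest_Path"
    "HOL-Analysis.Infinite_Sum"
begin

section \<open>Pointed graphs\<close>

text \<open>
  Simple undirected graphs, finite or infinite, are loop-free symmetric digraphs whose arcs are
  pairs of vertices (locale \<open>pair_bidirected_digraph\<close>).
\<close>

definition gdist :: "'a pair_pre_digraph \<Rightarrow> 'a \<Rightarrow> 'a \<Rightarrow> nat" where
  "gdist G u v = (LEAST n. \<exists>p. pre_digraph.awalk (with_proj G) u p v \<and> length p = n)"

definition sphere :: "'a pair_pre_digraph \<Rightarrow> nat \<Rightarrow> 'a \<Rightarrow> 'a set" where
  "sphere G n w = {w' \<in> pverts G. gdist G w w' = n}"

definition radii :: "'a pair_pre_digraph \<Rightarrow> 'a \<Rightarrow> nat set" where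
  "radii G v0 = {n. \<exists>v \<in> pverts G. gdist G v0 v = n}"

text \<open>
  The supremum is taken in the natural numbers and is meaningful only for a bounded set of radii;
  it is used only for finite graphs, where it is a maximum.
\<close>

definition max_radius :: "'a pair_pre_digraph \<Rightarrow> 'a \<Rightarrow> nat" where
  "max_radius G v0 = Sup (radii G v0)"

locale pointed_graph = pair_bidirected_digraph G for G :: "'a pair_pre_digraph" +
  fixes v0 :: 'a
  assumes base_in_verts: "v0 \<in> pverts G"
    and graph_connected: "Digraph_Component.connected (with_proj G)"
    and locally_finite: "\<And>v. v \<in> pverts G \<Longrightarrow> finite (out_arcs (with_proj G) v)"
    and countable_verts: "countable (pverts G)"
    and sphere_max_radius:
      "\<And>v. finite (pverts G) \<Longrightarrow> v \<in> pverts G \<Longrightarrow> sphere G (max_radius G v0) v \<noteq> {}"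

text \<open>\<open>trans_prob G v0 i j k\<close> is $p_{i,j}^k$: the upper index is the last argument.\<close>

definition trans_prob :: "'a pair_pre_digraph \<Rightarrow> 'a \<Rightarrow> nat \<Rightarrow> nat \<Rightarrow> nat \<Rightarrow> real" where
  "trans_prob G v0 i j k =
     1 / real (card (sphere G i v0)) *
     (\<Sum>v \<in> sphere G i v0.
        real (card (sphere G j v \<inter> sphere G k v0)) / real (card (sphere G j v)))"

definition supp_lower :: "'a pair_pre_digraph \<Rightarrow> 'a \<Rightarrow> nat \<Rightarrow> nat \<Rightarrow> nat set" where
  "supp_lower G v0 i k = {j \<in> radii G v0. trans_prob G v0 k i j \<noteq> 0}"

definition supp_upper :: "'a pair_pre_digraph \<Rightarrow> 'a \<Rightarrow> nat \<Rightarrow> nat \<Rightarrow> nat set" where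
  "supp_upper G v0 j k = {i \<in> radii G v0. trans_prob G v0 k i j \<noteq> 0}"

definition c_const :: "'a pair_pre_digraph \<Rightarrow> 'a \<Rightarrow> nat \<Rightarrow> real" where
  "c_const G v0 k = (SUP j \<in> radii G v0. \<Sum>i \<in> supp_upper G v0 j k. (trans_prob G v0 k i j)\<^sup>2)"

definition d_const :: "'a pair_pre_digraph \<Rightarrow> 'a \<Rightarrow> nat \<Rightarrow> real" where
  "d_const G v0 k = (SUP i \<in> radii G v0. real (card (supp_lower G v0 i k)))"


section \<open>Operators on square-summable sequences\<close>

text \<open>
  A sequence indexed by \<open>I\<close> is a function that vanishes outside \<open>I\<close>, so that two sequences are
  equal iff they agree on \<open>I\<close>.
\<close>

definition ell2 :: "'i set \<Rightarrow> ('i \<Rightarrow> complex) set" where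
  "ell2 I = {\<xi>. (\<forall>n. n \<notin> I \<longrightarrow> \<xi> n = 0) \<and> (\<lambda>n. (cmod (\<xi> n))\<^sup>2) summable_on I}"

definition ell2_norm :: "'i set \<Rightarrow> ('i \<Rightarrow> complex) \<Rightarrow> real" where
  "ell2_norm I \<xi> = sqrt (\<Sum>\<^sub>\<infinity>n\<in>I. (cmod (\<xi> n))\<^sup>2)"

text \<open>\<open>T\<close> is an operator with domain \<open>D\<close>.\<close>

definition bounded_operator_ell2 ::
    "'i set \<Rightarrow> ('i \<Rightarrow> complex) set \<Rightarrow> (('i \<Rightarrow> complex) \<Rightarrow> ('i \<Rightarrow> complex)) \<Rightarrow> bool" where
  "bounded_operator_ell2 I D T \<longleftrightarrow>
     D = ell2 I \<and>
     (\<forall>\<xi>\<in>D. T \<xi> \<in> ell2 I) \<and>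
     (\<forall>\<xi>\<in>D. \<forall>\<eta>\<in>D. T (\<lambda>n. \<xi> n + \<eta> n) = (\<lambda>n. T \<xi> n + T \<eta> n)) \<and>
     (\<forall>a. \<forall>\<xi>\<in>D. T (\<lambda>n. a * \<xi> n) = (\<lambda>n. a * T \<xi> n)) \<and>
     (\<exists>C. \<forall>\<xi>\<in>D. ell2_norm I (T \<xi>) \<le> C * ell2_norm I \<xi>)"

text \<open>Same formula as \<open>onorm\<close> in HOL-Analysis; the quotient is 0 at the zero sequence.\<close>

definition ell2_onorm ::
    "'i set \<Rightarrow> (('i \<Rightarrow> complex) \<Rightarrow> ('i \<Rightarrow> complex)) \<Rightarrow> real" where
  "ell2_onorm I T = (SUP \<xi>\<in>ell2 I. ell2_norm I (T \<xi>) / ell2_norm I \<xi>)"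

definition trans_op ::
    "'a pair_pre_digraph \<Rightarrow> 'a \<Rightarrow> nat \<Rightarrow> (nat \<Rightarrow> complex) \<Rightarrow> (nat \<Rightarrow> complex)" where
  "trans_op G v0 k \<xi> =
     (\<lambda>n. if n \<in> radii G v0
          then \<Sum>\<^sub>\<infinity>l\<in>radii G v0. complex_of_real (trans_prob G v0 k l n) * \<xi> l
          else 0)"

definition trans_op_dom :: "'a pair_pre_digraph \<Rightarrow> 'a \<Rightarrow> nat \<Rightarrow> (nat \<Rightarrow> complex) set" where
  "trans_op_dom G v0 k =
     {\<xi> \<in> ell2 (radii G v0).
        (\<lambda>n. (cmod (\<Sum>\<^sub>\<infinity>l\<in>radii G v0. complex_of_real (trans_prob G v0 k l n) * \<xi> l))\<^sup>2)
          summable_on radii G v0}"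


section \<open>The sums and suprema above are finite\<close>

context pointed_graph
begin

lemma awalk_exists:
  assumes "u \<in> pverts G" "v \<in> pverts G"
  shows "\<exists>p. pre_digraph.awalk (with_proj G) u p v"
proof -
  have "strongly_connected (with_proj G)"
    using graph_connected sym_arcs by (simp add: symmetric_connected_imp_strongly_connected)
  then show ?thesis
    using assms unfolding strongly_connected_def by (auto simp: reachable_awalk)
qed

lemma gdist_attained:
  assumes "u \<in> pverts G" "v \<in> pverts G"
  shows "\<exists>p. pre_digraph.awalk (with_proj G) u p v \<and> length p = gdist G u v"
  unfolding gdist_def by (rule LeastI_ex) (use awalk_exists[OF assms] in blast)

lemma gdist_le: "pre_digraph.awalk (with_proj G) u p v \<Longrightarrow> gdist G u v \<le> length p"
  unfolding gdist_def by (rule Least_le) blast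

lemma gdist_eq_mu:
  assumes "u \<in> pverts G" "v \<in> pverts G"
  shows "wf_digraph.\<mu> (with_proj G) (\<lambda>_. 1) u v = ereal (real (gdist G u v))"
proof -
  obtain p where p: "awalk u p v" "length p = gdist G u v"
    using gdist_attained[OF assms] by auto
  have cost: "awalk_cost (\<lambda>_. 1) q = real (length q)" for q :: "('a \<times> 'a) list"
    by (induct q) auto
  show ?thesis
    unfolding \<mu>_def
  proof (rule antisym)
    show "(INF q\<in>{q. awalk u q v}. ereal (awalk_cost (\<lambda>_. 1) q)) \<le> ereal (real (gdist G u v))"
      using p by (intro INF_lower2[of p]) (auto simp: cost)
    show "ereal (real (gdist G u v)) \<le> (INF q\<in>{q. awalk u q v}. ereal (awalk_cost (\<lambda>_. 1) q))"
      by (intro INF_greatest) (auto simp: cost intro: gdist_le)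
  qed
qed

lemma gdist_triangle:
  assumes "u \<in> pverts G" "v \<in> pverts G" "w \<in> pverts G"
  shows "gdist G u w \<le> gdist G u v + gdist G v w"
proof -
  obtain p q where "awalk u p v" "length p = gdist G u v" "awalk v q w" "length q = gdist G v w"
    using gdist_attained assms by metis
  then show ?thesis
    using gdist_le[of u "p @ q" w] by (auto intro: awalk_appendI)
qed

lemma awalk_reverse:
  assumes "awalk u p v"
  shows "awalk v (rev (map (\<lambda>(a, b). (b, a)) p)) u"
  using assms
proof (induct p arbitrary: u)
  case Nil
  then show ?case by (auto simp: awalk_Nil_iff)
next
  case (Cons e p)
  obtain a b where e: "e = (a, b)" by (cases e)
  have ab: "(a, b) \<in> parcs G" "u = a" "awalk b p v"
    using Cons.prems by (auto simp: e awalk_Cons_iff)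
  have "(b, a) \<in> parcs G"
    using ab(1) sym_arcs by (auto simp: symmetric_def elim: symE)
  then have "awalk b [(b, a)] a"
    by (auto simp: awalk_def dest: in_arcsD1 in_arcsD2)
  with Cons.hyps[OF ab(3)] show ?case
    by (auto simp: e ab(2) intro: awalk_appendI)
qed

lemma gdist_sym:
  assumes "u \<in> pverts G" "v \<in> pverts G"
  shows "gdist G u v = gdist G v u"
proof -
  have "gdist G y x \<le> gdist G x y" if xy: "x \<in> pverts G" "y \<in> pverts G" for x y
  proof -
    obtain p where "awalk x p y" "length p = gdist G x y"
      using gdist_attained[OF xy] by auto
    then show ?thesis
      using gdist_le[OF awalk_reverse] by force
  qed
  then show ?thesis using assms by (meson antisym)
qed

lemma finite_sphere:
  assumes "w \<in> pverts G"
  shows "finite (sphere G n w)"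
proof -
  have "finite {v. \<exists>p. awalk w p v \<and> length p = n}"
    using assms
  proof (induct n arbitrary: w)
    case 0
    have "{v. \<exists>p. awalk w p v \<and> length p = 0} \<subseteq> {w}"
      by (auto simp: awalk_Nil_iff)
    then show ?case by (rule finite_subset) simp
  next
    case (Suc n)
    have "{v. \<exists>p. awalk w p v \<and> length p = Suc n}
        \<subseteq> (\<Union>e \<in> out_arcs (with_proj G) w. {v. \<exists>p. awalk (snd e) p v \<and> length p = n})"
      by (fastforce simp: length_Suc_conv awalk_Cons_iff out_arcs_def)
    moreover have "finite \<dots>"
      using Suc locally_finite arc_snd_in_verts by (intro finite_UN_I) auto
    ultimately show ?case by (rule finite_subset)
  qed
  moreover have "sphere G n w \<subseteq> {v. \<exists>p. awalk w p v \<and> length p = n}"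
    using gdist_attained[OF assms] by (auto simp: sphere_def)
  ultimately show ?thesis by (rule finite_subset[rotated])
qed

lemma trans_prob_nonzeroD:
  assumes "trans_prob G v0 k i j \<noteq> 0"
  shows "j \<le> k + i" "i \<le> k + j"
proof -
  obtain v where v: "v \<in> sphere G k v0"
    and "card (sphere G i v \<inter> sphere G j v0) \<noteq> 0"
    using assms unfolding trans_prob_def
    by (metis (no_types, lifting) div_0 mult_eq_0_iff of_nat_0 sum.neutral)
  then obtain w where w: "w \<in> sphere G i v" "w \<in> sphere G j v0"
    by (metis IntE card.empty ex_in_conv)
  show "j \<le> k + i"
    using gdist_triangle[of v0 v w] v w base_in_verts by (auto simp: sphere_def)
  show "i \<le> k + j"
    using gdist_triangle[of v v0 w] gdist_sym[of v v0] v w base_in_verts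
    by (auto simp: sphere_def)
qed

lemma supp_lower_subset: "supp_lower G v0 i k \<subseteq> {i - k..i + k}"
  using trans_prob_nonzeroD by (force simp: supp_lower_def)

lemma supp_upper_subset: "supp_upper G v0 j k \<subseteq> {j - k..j + k}"
  using trans_prob_nonzeroD by (force simp: supp_upper_def)

lemma finite_supp: "finite (supp_lower G v0 i k)" "finite (supp_upper G v0 j k)"
  using supp_lower_subset supp_upper_subset by (meson finite_atLeastAtMost finite_subset)+

lemma card_supp: "card (supp_lower G v0 i k) \<le> 2 * k + 1" "card (supp_upper G v0 j k) \<le> 2 * k + 1"
  using card_mono[OF _ supp_lower_subset, of i k] card_mono[OF _ supp_upper_subset, of j k] by auto

lemma trans_prob_nonneg: "0 \<le> trans_prob G v0 i j k"
  unfolding trans_prob_def by (intro mult_nonneg_nonneg sum_nonneg) auto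

lemma trans_prob_le_1: "trans_prob G v0 i j k \<le> 1"
proof -
  have "real (card (sphere G j v \<inter> sphere G k v0)) / real (card (sphere G j v)) \<le> 1" for v
    proof (cases "finite (sphere G j v)")
    case True
    then have "card (sphere G j v \<inter> sphere G k v0) \<le> card (sphere G j v)"
      by (intro card_mono) auto
    then show ?thesis by (cases "card (sphere G j v) = 0") (simp_all add: divide_le_eq_1 del: card_eq_0_iff)
  qed simp
  then have "(\<Sum>v \<in> sphere G i v0.
      real (card (sphere G j v \<inter> sphere G k v0)) / real (card (sphere G j v)))
      \<le> real (card (sphere G i v0)) * 1"
    by (intro sum_bounded_above)
  then show ?thesis
    unfolding trans_prob_def by (cases "card (sphere G i v0) = 0") (auto simp: divide_le_eq_1)
qed

lemma bdd_above_c_const: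
  "bdd_above ((\<lambda>j. \<Sum>i \<in> supp_upper G v0 j k. (trans_prob G v0 k i j)\<^sup>2) ` radii G v0)"
proof (rule bdd_aboveI2)
  fix j
  have "(\<Sum>i \<in> supp_upper G v0 j k. (trans_prob G v0 k i j)\<^sup>2) \<le> real (card (supp_upper G v0 j k)) * 1"
    using trans_prob_nonneg trans_prob_le_1
    by (intro sum_bounded_above) (simp add: power_le_one)
  also have "\<dots> \<le> real (2 * k + 1)"
    using card_supp(2) by (simp only: mult_1_right of_nat_le_iff)
  finally show "(\<Sum>i \<in> supp_upper G v0 j k. (trans_prob G v0 k i j)\<^sup>2) \<le> real (2 * k + 1)" .
qed

lemma bdd_above_d_const: "bdd_above ((\<lambda>i. real (card (supp_lower G v0 i k))) ` radii G v0)"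
  by (rule bdd_aboveI2[of _ _ "real (2 * k + 1)"]) (use card_supp(1) in \<open>simp only: of_nat_le_iff\<close>)

end

end

theory Submission
  imports Defs "HOL-Analysis.Convex"
begin

text \<open>
  Upper bound: Cauchy--Schwarz gives
  $|P_k(\xi)_n|^2 \le c_k \sum_{l \in \mathrm{Supp}^n(k)} |\xi_l|^2$, and summing over $n$ counts each
  $|\xi_l|^2$ exactly $|\mathrm{Supp}_l(k)| \le d_k$ times.
  Lower bound: let $\xi$ be the indicator of the radii up to $N$, of which there are $m$. As
  $\sum_n p_{k,l}^n = 1$, the entries of $P_k(\xi)$ sum to $m$, and they vanish outside the radii up to
  $N + k$, of which there are at most $m + k$. So $m^2 \le (m + k) \|P_k(\xi)\|^2$ while
  $\|\xi\|^2 = m$. If there are infinitely many radii, let $m \to \infty$; otherwise choose $N$ beyond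
  the largest one, so that $m + k$ may be replaced by $m$.
\<close>

section \<open>Norm estimates for square-summable sequences\<close>

lemma ell2_summable: "\<xi> \<in> ell2 I \<Longrightarrow> (\<lambda>n. (cmod (\<xi> n))\<^sup>2) summable_on I"
  by (simp add: ell2_def)

lemma ell2_norm_nonneg: "0 \<le> ell2_norm I \<xi>"
  by (simp add: ell2_norm_def infsum_nonneg)

lemma ell2_norm_sq: "(ell2_norm I \<xi>)\<^sup>2 = (\<Sum>\<^sub>\<infinity>n\<in>I. (cmod (\<xi> n))\<^sup>2)"
  by (simp add: ell2_norm_def infsum_nonneg)

lemma ell2_norm_sq_finite_support:
  assumes "finite F" "F \<subseteq> I" "\<And>n. n \<in> I - F \<Longrightarrow> \<xi> n = 0"
  shows "(ell2_norm I \<xi>)\<^sup>2 = (\<Sum>n\<in>F. (cmod (\<xi> n))\<^sup>2)"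
proof -
  have "(\<Sum>\<^sub>\<infinity>n\<in>I. (cmod (\<xi> n))\<^sup>2) = (\<Sum>\<^sub>\<infinity>n\<in>F. (cmod (\<xi> n))\<^sup>2)"
    using assms by (intro infsum_cong_neutral) auto
  then show ?thesis using assms(1) by (simp add: ell2_norm_sq)
qed

lemma sum_le_ell2_norm_sq:
  assumes "\<xi> \<in> ell2 I" "finite F" "F \<subseteq> I"
  shows "(\<Sum>n\<in>F. (cmod (\<xi> n))\<^sup>2) \<le> (ell2_norm I \<xi>)\<^sup>2"
  unfolding ell2_norm_sq
  by (rule finite_sum_le_infsum) (use assms in \<open>auto simp: ell2_summable\<close>)

text \<open>The terms are nonnegative, so bounded finite partial sums give summability as well as
  the norm bound. This lets the upper estimate work with finite sums only.\<close>

lemma ell2_norm_le_of_finite_sums: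
  assumes zero: "\<And>n. n \<notin> I \<Longrightarrow> \<eta> n = 0"
    and bound: "\<And>F. finite F \<Longrightarrow> F \<subseteq> I \<Longrightarrow> (\<Sum>n\<in>F. (cmod (\<eta> n))\<^sup>2) \<le> B\<^sup>2"
    and B: "0 \<le> B"
  shows "\<eta> \<in> ell2 I" "ell2_norm I \<eta> \<le> B"
proof -
  have summable: "(\<lambda>n. (cmod (\<eta> n))\<^sup>2) summable_on I"
    by (rule nonneg_bdd_above_summable_on) (auto intro!: bdd_aboveI2[where M = "B\<^sup>2"] bound)
  then show "\<eta> \<in> ell2 I" using zero by (simp add: ell2_def)
  have "(ell2_norm I \<eta>)\<^sup>2 \<le> B\<^sup>2"
    unfolding ell2_norm_sq by (rule infsum_le_finite_sums[OF summable bound])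
  then show "ell2_norm I \<eta> \<le> B" using B by (rule power2_le_imp_le)
qed

text \<open>The triangle inequality reduces this to the real Cauchy-Schwarz inequality for the
  absolute values.\<close>

lemma cmod_sum_mult_sq_le:
  fixes a :: "'b \<Rightarrow> real" and z :: "'b \<Rightarrow> complex"
  shows "(cmod (\<Sum>l\<in>S. complex_of_real (a l) * z l))\<^sup>2 \<le> (\<Sum>l\<in>S. (a l)\<^sup>2) * (\<Sum>l\<in>S. (cmod (z l))\<^sup>2)"
proof -
  have "cmod (\<Sum>l\<in>S. complex_of_real (a l) * z l) \<le> (\<Sum>l\<in>S. \<bar>a l\<bar> * cmod (z l))"
    by (rule sum_norm_le) (simp add: norm_mult)
  then have "(cmod (\<Sum>l\<in>S. complex_of_real (a l) * z l))\<^sup>2 \<le> (\<Sum>l\<in>S. \<bar>a l\<bar> * cmod (z l))\<^sup>2"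
    by (intro power_mono) auto
  also have "\<dots> \<le> (\<Sum>l\<in>S. \<bar>a l\<bar>\<^sup>2) * (\<Sum>l\<in>S. (cmod (z l))\<^sup>2)"
    by (rule Cauchy_Schwarz_ineq_sum)
  finally show ?thesis by simp
qed

section \<open>Nonempty spheres and total mass of the transition probabilities\<close>

context pointed_graph
begin

text \<open>Cut a shortest walk from \<open>v\<close> to \<open>w\<close> after \<open>n\<close>
  steps. The cut point has distance exactly \<open>n\<close> from \<open>v\<close>, since a smaller
  distance would give a shorter connection to \<open>w\<close>.\<close>

lemma sphere_nonempty_of_le_gdist:
  assumes v: "v \<in> pverts G" and w: "w \<in> pverts G" and n: "n \<le> gdist G v w"
  shows "sphere G n v \<noteq> {}"
proof -
  obtain p where p: "awalk v p w" "length p = gdist G v w"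
    using gdist_attained[OF v w] by auto
  then obtain x where x: "awalk v (take n p) x" "awalk x (drop n p) w"
    by (metis append_take_drop_id awalk_append_iff)
  then have xG: "x \<in> pverts G" by auto
  have "gdist G v x \<le> n" "gdist G x w \<le> gdist G v w - n"
    using gdist_le[OF x(1)] gdist_le[OF x(2)] p(2) n by auto
  then have "gdist G v x = n" using gdist_triangle[OF v xG w] n by linarith
  then show ?thesis using xG by (auto simp: sphere_def)
qed

text \<open>It suffices to find a vertex at distance at least \<open>n\<close> from
  \<open>v\<close>. In a finite graph the standing assumption on \<open>max_radius\<close> provides
  one; in an infinite graph, balls are finite by local finiteness and cannot contain all
  vertices.\<close>

lemma sphere_nonempty:
  assumes v: "v \<in> pverts G" and n: "n \<in> radii G v0"
  shows "sphere G n v \<noteq> {}"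
proof (cases "finite (pverts G)")
  case True
  have "finite (radii G v0)"
    using True by (auto simp: radii_def intro: finite_subset[of _ "gdist G v0 ` pverts G"])
  then have "n \<le> max_radius G v0"
    unfolding max_radius_def using n by (intro cSup_upper) auto
  moreover obtain w where "w \<in> sphere G (max_radius G v0) v"
    using sphere_max_radius[OF True v] by auto
  ultimately show ?thesis
    using sphere_nonempty_of_le_gdist[OF v] by (auto simp: sphere_def)
next
  case False
  have "\<exists>w\<in>pverts G. n \<le> gdist G v w"
  proof (rule ccontr)
    assume "\<not> ?thesis"
    then have "pverts G \<subseteq> (\<Union>m<n. sphere G m v)"
      by (auto simp: sphere_def not_le)
    with False show False
      using finite_sphere[OF v] by (meson finite_UN_I finite_lessThan finite_subset)
  qed
  then show ?thesis using sphere_nonempty_of_le_gdist[OF v] by auto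
qed

text \<open>For each \<open>v\<close> in the sphere of radius \<open>k\<close>, the nonempty sphere
  of radius \<open>l\<close> around \<open>v\<close> is partitioned by distance from
  \<open>v0\<close>, so the fractions for \<open>v\<close> add up to 1. The set \<open>F\<close> may
  exceed the support, so that one set can serve several \<open>l\<close> at once.\<close>

lemma sum_trans_prob:
  assumes k: "k \<in> radii G v0" and l: "l \<in> radii G v0"
    and F: "finite F" "supp_lower G v0 l k \<subseteq> F" "F \<subseteq> radii G v0"
  shows "(\<Sum>n\<in>F. trans_prob G v0 k l n) = 1"
proof -
  \<comment> \<open>By the triangle inequality, \<open>J\<close> contains every radius met by the
    spheres in question. It is finite and independent of \<open>v\<close>, so the two sums can be
    swapped.\<close>
  define J where "J = radii G v0 \<inter> {..k + l}"
  have "(\<Sum>n\<in>F. trans_prob G v0 k l n) = (\<Sum>n\<in>supp_lower G v0 l k. trans_prob G v0 k l n)"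
    using F by (intro sum.mono_neutral_right) (auto simp: supp_lower_def)
  also have "\<dots> = (\<Sum>n\<in>J. trans_prob G v0 k l n)"
    using trans_prob_nonzeroD by (intro sum.mono_neutral_left) (auto simp: supp_lower_def J_def)
  also have "\<dots> = 1 / real (card (sphere G k v0)) * (\<Sum>v \<in> sphere G k v0. \<Sum>n\<in>J.
      real (card (sphere G l v \<inter> sphere G n v0)) / real (card (sphere G l v)))"
    unfolding trans_prob_def sum_distrib_left[symmetric] by (subst sum.swap) simp
  also have "(\<Sum>v \<in> sphere G k v0. \<Sum>n\<in>J.
      real (card (sphere G l v \<inter> sphere G n v0)) / real (card (sphere G l v)))
      = (\<Sum>v \<in> sphere G k v0. 1)"
  proof (rule sum.cong[OF refl])
    fix v assume "v \<in> sphere G k v0"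
    then have v: "v \<in> pverts G" "gdist G v0 v = k" by (auto simp: sphere_def)
    have fin: "finite (sphere G l v)" using v(1) by (rule finite_sphere)
    have "gdist G v0 w \<le> k + l" if "w \<in> sphere G l v" for w
      using gdist_triangle[of v0 v w] that v base_in_verts by (auto simp: sphere_def)
    then have "sphere G l v = (\<Union>n\<in>J. sphere G l v \<inter> sphere G n v0)"
      by (auto simp: J_def sphere_def radii_def)
    then have "card (sphere G l v) = card (\<Union>n\<in>J. sphere G l v \<inter> sphere G n v0)"
      by simp
    also have "\<dots> = (\<Sum>n\<in>J. card (sphere G l v \<inter> sphere G n v0))"
      using fin by (intro card_UN_disjoint) (auto simp: J_def sphere_def)
    finally have "(\<Sum>n\<in>J. real (card (sphere G l v \<inter> sphere G n v0))) = real (card (sphere G l v))"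
      by simp
    then show "(\<Sum>n\<in>J. real (card (sphere G l v \<inter> sphere G n v0)) / real (card (sphere G l v))) = 1"
      using fin sphere_nonempty[OF v(1) l] by (simp add: sum_divide_distrib[symmetric])
  qed
  finally show ?thesis
    using sphere_nonempty[OF base_in_verts k] finite_sphere[OF base_in_verts] by simp
qed

section \<open>The operator as a finite sum\<close>

lemma trans_op_series_eq_sum:
  assumes S: "finite S" "supp_upper G v0 n k \<subseteq> S" "S \<subseteq> radii G v0"
  shows "(\<Sum>\<^sub>\<infinity>l\<in>radii G v0. complex_of_real (trans_prob G v0 k l n) * \<xi> l)
    = (\<Sum>l\<in>S. complex_of_real (trans_prob G v0 k l n) * \<xi> l)"
proof -
  have "(\<Sum>\<^sub>\<infinity>l\<in>radii G v0. complex_of_real (trans_prob G v0 k l n) * \<xi> l)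
    = (\<Sum>\<^sub>\<infinity>l\<in>S. complex_of_real (trans_prob G v0 k l n) * \<xi> l)"
    using S by (intro infsum_cong_neutral) (auto simp: supp_upper_def)
  then show ?thesis using S(1) by simp
qed

lemma trans_op_eq_sum:
  "trans_op G v0 k \<xi> n = (if n \<in> radii G v0
     then \<Sum>l\<in>supp_upper G v0 n k. complex_of_real (trans_prob G v0 k l n) * \<xi> l else 0)"
proof -
  have "supp_upper G v0 n k \<subseteq> radii G v0" by (auto simp: supp_upper_def)
  then show ?thesis
    using trans_op_series_eq_sum[OF finite_supp(2) subset_refl] by (simp add: trans_op_def)
qed

lemma trans_op_add:
  "trans_op G v0 k (\<lambda>n. \<xi> n + \<eta> n) = (\<lambda>n. trans_op G v0 k \<xi> n + trans_op G v0 k \<eta> n)"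
  by (rule ext) (simp add: trans_op_eq_sum sum.distrib distrib_left)

lemma trans_op_scale: "trans_op G v0 k (\<lambda>n. a * \<xi> n) = (\<lambda>n. a * trans_op G v0 k \<xi> n)"
  by (rule ext) (simp add: trans_op_eq_sum sum_distrib_left mult.left_commute)

section \<open>Upper bound and boundedness\<close>

lemma c_const_nonneg: "0 \<le> c_const G v0 k"
proof -
  have "gdist G v0 v0 \<in> radii G v0" using base_in_verts by (auto simp: radii_def)
  then show ?thesis
    unfolding c_const_def using bdd_above_c_const
    by (intro cSUP_upper2[of _ _ "gdist G v0 v0"]) (auto intro: sum_nonneg)
qed

lemma d_const_nonneg: "0 \<le> d_const G v0 k"
proof -
  have "gdist G v0 v0 \<in> radii G v0" using base_in_verts by (auto simp: radii_def)
  then show ?thesis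
    unfolding d_const_def using bdd_above_d_const
    by (intro cSUP_upper2[of _ _ "gdist G v0 v0"]) auto
qed

lemma sum_trans_op_sq_le:
  assumes \<xi>: "\<xi> \<in> ell2 (radii G v0)" and F: "finite F" "F \<subseteq> radii G v0"
  shows "(\<Sum>n\<in>F. (cmod (trans_op G v0 k \<xi> n))\<^sup>2)
    \<le> c_const G v0 k * d_const G v0 k * (ell2_norm (radii G v0) \<xi>)\<^sup>2"
proof -
  let ?c = "c_const G v0 k" and ?d = "d_const G v0 k"
  \<comment> \<open>A finite set of all indices \<open>l\<close> that occur, so that the double sum
    below can be reordered by \<open>l\<close> first.\<close>
  define L where "L = (\<Union>n\<in>F. supp_upper G v0 n k)"
  have L: "finite L" "L \<subseteq> radii G v0"
    using F finite_supp(2) by (auto simp: L_def supp_upper_def)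
  have row: "(cmod (trans_op G v0 k \<xi> n))\<^sup>2 \<le> ?c * (\<Sum>l\<in>supp_upper G v0 n k. (cmod (\<xi> l))\<^sup>2)"
    if n: "n \<in> F" for n
  proof -
    have "(cmod (trans_op G v0 k \<xi> n))\<^sup>2 \<le> (\<Sum>l\<in>supp_upper G v0 n k. (trans_prob G v0 k l n)\<^sup>2)
        * (\<Sum>l\<in>supp_upper G v0 n k. (cmod (\<xi> l))\<^sup>2)"
      using n F cmod_sum_mult_sq_le by (auto simp: trans_op_eq_sum)
    also have "\<dots> \<le> ?c * (\<Sum>l\<in>supp_upper G v0 n k. (cmod (\<xi> l))\<^sup>2)"
      unfolding c_const_def using n F bdd_above_c_const
      by (intro mult_right_mono cSUP_upper sum_nonneg) auto
    finally show ?thesis .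
  qed
  have column: "(\<Sum>n\<in>{n \<in> F. l \<in> supp_upper G v0 n k}. (cmod (\<xi> l))\<^sup>2) \<le> ?d * (cmod (\<xi> l))\<^sup>2"
    if l: "l \<in> L" for l
  proof -
    \<comment> \<open>For radii \<open>l\<close> and \<open>n\<close>, membership of
      \<open>l\<close> in \<open>supp_upper G v0 n k\<close> and of \<open>n\<close> in
      \<open>supp_lower G v0 l k\<close> are the same condition.\<close>
    have "card {n \<in> F. l \<in> supp_upper G v0 n k} \<le> card (supp_lower G v0 l k)"
      using F by (intro card_mono finite_supp) (auto simp: supp_upper_def supp_lower_def)
    moreover have "real (card (supp_lower G v0 l k)) \<le> ?d"
      unfolding d_const_def using l L bdd_above_d_const by (intro cSUP_upper) auto
    ultimately have "real (card {n \<in> F. l \<in> supp_upper G v0 n k}) \<le> ?d" by linarith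
    then show ?thesis by (simp add: mult_right_mono)
  qed
  have "(\<Sum>n\<in>F. (cmod (trans_op G v0 k \<xi> n))\<^sup>2)
      \<le> ?c * (\<Sum>n\<in>F. \<Sum>l\<in>supp_upper G v0 n k. (cmod (\<xi> l))\<^sup>2)"
    unfolding sum_distrib_left[of ?c] by (rule sum_mono) (use row in \<open>simp add: sum_distrib_left\<close>)
  also have "(\<Sum>n\<in>F. \<Sum>l\<in>supp_upper G v0 n k. (cmod (\<xi> l))\<^sup>2)
      = (\<Sum>n\<in>F. \<Sum>l\<in>{l \<in> L. l \<in> supp_upper G v0 n k}. (cmod (\<xi> l))\<^sup>2)"
    by (intro sum.cong refl) (auto simp: L_def)
  also have "\<dots> = (\<Sum>l\<in>L. \<Sum>n\<in>{n \<in> F. l \<in> supp_upper G v0 n k}. (cmod (\<xi> l))\<^sup>2)"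
    by (rule sum.swap_restrict[OF F(1) L(1)])
  also have "?c * \<dots> \<le> ?c * (?d * (\<Sum>l\<in>L. (cmod (\<xi> l))\<^sup>2))"
    unfolding sum_distrib_left[of ?d] using column c_const_nonneg
    by (intro mult_left_mono sum_mono) auto
  also have "\<dots> \<le> ?c * (?d * (ell2_norm (radii G v0) \<xi>)\<^sup>2)"
    using sum_le_ell2_norm_sq[OF \<xi> L] c_const_nonneg d_const_nonneg by (intro mult_left_mono) auto
  finally show ?thesis by (simp add: mult.assoc)
qed

lemma
  assumes \<xi>: "\<xi> \<in> ell2 (radii G v0)"
  shows trans_op_in_ell2: "trans_op G v0 k \<xi> \<in> ell2 (radii G v0)"
    and ell2_norm_trans_op_le: "ell2_norm (radii G v0) (trans_op G v0 k \<xi>)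
      \<le> sqrt (c_const G v0 k * d_const G v0 k) * ell2_norm (radii G v0) \<xi>" (is "_ \<le> ?B")
proof -
  have zero: "trans_op G v0 k \<xi> n = 0" if "n \<notin> radii G v0" for n
    using that by (simp add: trans_op_def)
  have bound: "(\<Sum>n\<in>F. (cmod (trans_op G v0 k \<xi> n))\<^sup>2) \<le> ?B\<^sup>2"
    if "finite F" "F \<subseteq> radii G v0" for F
    using sum_trans_op_sq_le[OF \<xi> that] c_const_nonneg d_const_nonneg
    by (simp add: power_mult_distrib)
  have B: "0 \<le> ?B"
    by (simp add: c_const_nonneg d_const_nonneg ell2_norm_nonneg)
  show "trans_op G v0 k \<xi> \<in> ell2 (radii G v0)"
    and "ell2_norm (radii G v0) (trans_op G v0 k \<xi>) \<le> ?B"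
    by (rule ell2_norm_le_of_finite_sums[OF zero bound B]; assumption)+
qed

text \<open>The summability condition defining the domain says that the image is square-summable,
  which the upper estimate guarantees for every sequence in \<open>ell2\<close>.\<close>

lemma trans_op_dom_eq_ell2: "trans_op_dom G v0 k = ell2 (radii G v0)"
proof -
  have "(\<lambda>n. (cmod (\<Sum>\<^sub>\<infinity>l\<in>radii G v0. complex_of_real (trans_prob G v0 k l n) * \<xi> l))\<^sup>2)
      summable_on radii G v0" if "\<xi> \<in> ell2 (radii G v0)" for \<xi>
    using ell2_summable[OF trans_op_in_ell2[OF that, of k]]
    by (rule summable_on_cong[THEN iffD1, rotated]) (simp add: trans_op_def)
  then show ?thesis by (auto simp: trans_op_dom_def)
qed

lemma bounded_trans_op:
  "bounded_operator_ell2 (radii G v0) (trans_op_dom G v0 k) (trans_op G v0 k)"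
  unfolding bounded_operator_ell2_def trans_op_dom_eq_ell2
proof (intro conjI exI ballI allI)
  show "ell2_norm (radii G v0) (trans_op G v0 k \<xi>)
      \<le> sqrt (c_const G v0 k * d_const G v0 k) * ell2_norm (radii G v0) \<xi>"
    if "\<xi> \<in> ell2 (radii G v0)" for \<xi>
    by (rule ell2_norm_trans_op_le[OF that])
qed (simp_all only: trans_op_in_ell2 trans_op_add trans_op_scale)

section \<open>The operator norm as a supremum\<close>

lemma trans_op_quotient_le:
  assumes "\<xi> \<in> ell2 (radii G v0)"
  shows "ell2_norm (radii G v0) (trans_op G v0 k \<xi>) / ell2_norm (radii G v0) \<xi>
    \<le> sqrt (c_const G v0 k * d_const G v0 k)"
proof (cases "ell2_norm (radii G v0) \<xi> = 0")
  case True
  then show ?thesis using c_const_nonneg d_const_nonneg by simp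
next
  case False
  then have "0 < ell2_norm (radii G v0) \<xi>" using ell2_norm_nonneg by (simp add: less_le)
  then show ?thesis using ell2_norm_trans_op_le[OF assms] by (simp add: divide_le_eq)
qed

lemma ell2_onorm_trans_op_le:
  "ell2_onorm (radii G v0) (trans_op G v0 k) \<le> sqrt (c_const G v0 k * d_const G v0 k)"
proof -
  \<comment> \<open>The zero sequence shows that the supremum is over a nonempty set.\<close>
  have "(\<lambda>_. 0) \<in> ell2 (radii G v0)" by (simp add: ell2_def)
  then show ?thesis
    unfolding ell2_onorm_def using trans_op_quotient_le by (intro cSUP_least) auto
qed

lemma trans_op_quotient_le_onorm:
  assumes "\<xi> \<in> ell2 (radii G v0)"
  shows "ell2_norm (radii G v0) (trans_op G v0 k \<xi>) / ell2_norm (radii G v0) \<xi>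
    \<le> ell2_onorm (radii G v0) (trans_op G v0 k)"
  unfolding ell2_onorm_def using assms trans_op_quotient_le
  by (intro cSUP_upper bdd_aboveI2) auto

section \<open>Lower bound\<close>

text \<open>Test the operator on the indicator of \<open>A\<close>: the image has total mass
  \<open>card A\<close> on \<open>B\<close>, and Cauchy-Schwarz against the constant 1 on
  \<open>B\<close> bounds that mass by the norm. Leaving \<open>A\<close> and \<open>B\<close> free
  covers both finite and infinite sets of radii.\<close>

lemma card_le_card_mult_onorm_sq:
  assumes k: "k \<in> radii G v0"
    and A: "finite A" "A \<subseteq> radii G v0" "A \<noteq> {}"
    and B: "finite B" "B \<subseteq> radii G v0" "\<And>l. l \<in> A \<Longrightarrow> supp_lower G v0 l k \<subseteq> B"
  shows "real (card A) \<le> real (card B) * (ell2_onorm (radii G v0) (trans_op G v0 k))\<^sup>2"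
proof -
  let ?I = "radii G v0" and ?P = "trans_op G v0 k"
  define \<xi> :: "nat \<Rightarrow> complex" where "\<xi> n = of_bool (n \<in> A)" for n
  have norm\<xi>: "(ell2_norm ?I \<xi>)\<^sup>2 = real (card A)"
    using ell2_norm_sq_finite_support[OF A(1,2), of \<xi>] by (simp add: \<xi>_def)
  have \<xi>: "\<xi> \<in> ell2 ?I"
  proof -
    have "(\<lambda>n. (cmod (\<xi> n))\<^sup>2) summable_on ?I \<longleftrightarrow> (\<lambda>n. (cmod (\<xi> n))\<^sup>2) summable_on A"
      using A by (intro summable_on_cong_neutral) (auto simp: \<xi>_def)
    then show ?thesis using A by (auto simp: ell2_def \<xi>_def)
  qed
  have P\<xi>: "?P \<xi> n = complex_of_real (\<Sum>l\<in>A. trans_prob G v0 k l n)" if n: "n \<in> ?I" for n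
  proof -
    \<comment> \<open>The support is enlarged by \<open>A\<close> so that the sum can then be cut
      down to \<open>A\<close>, outside of which the indicator vanishes.\<close>
    have S: "finite (A \<union> supp_upper G v0 n k)" "A \<union> supp_upper G v0 n k \<subseteq> ?I"
      using A finite_supp(2) by (auto simp: supp_upper_def)
    have "?P \<xi> n = (\<Sum>l\<in>A \<union> supp_upper G v0 n k. complex_of_real (trans_prob G v0 k l n) * \<xi> l)"
      using n trans_op_series_eq_sum[OF S(1) _ S(2)] by (simp add: trans_op_def)
    also have "\<dots> = (\<Sum>l\<in>A. complex_of_real (trans_prob G v0 k l n))"
      using S by (intro sum.mono_neutral_cong_right) (auto simp: \<xi>_def)
    finally show ?thesis by simp
  qed
  have "real (card A) = (\<Sum>l\<in>A. \<Sum>n\<in>B. trans_prob G v0 k l n)"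
    using sum_trans_prob[OF k _ B(1) B(3) B(2)] A by (simp add: subset_iff)
  also have "\<dots> = (\<Sum>n\<in>B. \<Sum>l\<in>A. trans_prob G v0 k l n)" by (rule sum.swap)
  \<comment> \<open>The entries are nonnegative reals, hence equal to their moduli; the factor 1
    prepares Cauchy-Schwarz.\<close>
  also have "\<dots> = (\<Sum>n\<in>B. 1 * cmod (?P \<xi> n))"
    using B(2) by (intro sum.cong) (auto simp: P\<xi> subset_iff trans_prob_nonneg sum_nonneg
        simp del: of_real_sum)
  finally have "(real (card A))\<^sup>2 = (\<Sum>n\<in>B. 1 * cmod (?P \<xi> n))\<^sup>2" by simp
  also have "\<dots> \<le> (\<Sum>n\<in>B. 1\<^sup>2) * (\<Sum>n\<in>B. (cmod (?P \<xi> n))\<^sup>2)"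
    by (rule Cauchy_Schwarz_ineq_sum)
  also have "\<dots> \<le> real (card B) * (ell2_norm ?I (?P \<xi>))\<^sup>2"
    using sum_le_ell2_norm_sq[OF trans_op_in_ell2[OF \<xi>] B(1,2)] by (simp add: mult_left_mono)
  also have "\<dots> \<le> real (card B) * (ell2_onorm ?I ?P * ell2_norm ?I \<xi>)\<^sup>2"
  proof -
    have "ell2_norm ?I \<xi> \<noteq> 0" using norm\<xi> A by auto
    then have "0 < ell2_norm ?I \<xi>" using ell2_norm_nonneg by (simp add: less_le)
    then have "ell2_norm ?I (?P \<xi>) \<le> ell2_onorm ?I ?P * ell2_norm ?I \<xi>"
      using trans_op_quotient_le_onorm[OF \<xi>, of k] by (simp add: divide_le_eq)
    then show ?thesis using ell2_norm_nonneg by (intro mult_left_mono power_mono) auto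
  qed
  also have "\<dots> = real (card A) * (real (card B) * (ell2_onorm ?I ?P)\<^sup>2)"
    by (simp add: power_mult_distrib norm\<xi>)
  finally show ?thesis using A by (simp add: power2_eq_square card_gt_0_iff)
qed

lemma ell2_onorm_trans_op_ge:
  assumes k: "k \<in> radii G v0"
  shows "1 \<le> ell2_onorm (radii G v0) (trans_op G v0 k)"
proof -
  let ?I = "radii G v0" and ?x = "ell2_onorm (radii G v0) (trans_op G v0 k)"
  \<comment> \<open>The zero sequence contributes the quotient 0/0, which is 0.\<close>
  have "0 \<le> ?x"
    using trans_op_quotient_le_onorm[of "\<lambda>_. 0" k] by (simp add: ell2_def ell2_norm_def)
  moreover have "1 \<le> ?x\<^sup>2"
  proof (cases "finite ?I")
    case True
    \<comment> \<open>Take \<open>A\<close> and \<open>B\<close> both equal to the set of all radii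
      and cancel its positive cardinality.\<close>
    then show ?thesis
      using card_le_card_mult_onorm_sq[OF k True subset_refl _ True subset_refl] k
      by (force simp: supp_lower_def card_gt_0_iff)
  next
    case False
    show ?thesis
    proof (rule ccontr)
      assume "\<not> 1 \<le> ?x\<^sup>2"
      then have less: "?x\<^sup>2 < 1" by simp
      \<comment> \<open>The final inequality, \<open>card A\<close> at most
        \<open>card A + k\<close> times \<open>?x\<^sup>2\<close>, would force \<open>card A\<close>
        below this quotient; so \<open>m\<close> is chosen above it.\<close>
      obtain m :: nat where m: "real k * ?x\<^sup>2 / (1 - ?x\<^sup>2) < real m"
        using reals_Archimedean2 by blast
      obtain C where C: "finite C" "card C = Suc m" "C \<subseteq> ?I"
        using infinite_arbitrarily_large[OF False] by blast
      \<comment> \<open>\<open>C\<close> only makes the truncation large: \<open>A\<close> contains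
        \<open>C\<close>, and passing from \<open>A\<close> to \<open>B\<close> adds at most the
        \<open>k\<close> numbers just above \<open>N\<close>.\<close>
      define N where "N = Max C"
      define A where "A = ?I \<inter> {..N}"
      define B where "B = ?I \<inter> {..N + k}"
      have "C \<subseteq> A" using C by (auto simp: A_def N_def)
      then have cardA: "m < card A"
        using card_mono[of A C] C(2) by (simp add: A_def)
      have "card B \<le> card (A \<union> {N<..N + k})"
        by (rule card_mono) (auto simp: A_def B_def)
      also have "\<dots> \<le> card A + k"
        using card_Un_le[of A "{N<..N + k}"] by simp
      finally have cardB: "real (card B) \<le> real (card A) + real k" by linarith
      have "real (card A) \<le> real (card B) * ?x\<^sup>2"
      proof (rule card_le_card_mult_onorm_sq[OF k])
        show "A \<noteq> {}" using cardA by auto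
        show "supp_lower G v0 l k \<subseteq> B" if "l \<in> A" for l
          using supp_lower_subset[of l k] that by (fastforce simp: A_def B_def supp_lower_def)
      qed (auto simp: A_def B_def)
      also have "\<dots> \<le> (real (card A) + real k) * ?x\<^sup>2"
        using cardB by (intro mult_right_mono) auto
      finally have "real (card A) * (1 - ?x\<^sup>2) \<le> real k * ?x\<^sup>2"
        by (simp add: algebra_simps)
      then have "real (card A) \<le> real k * ?x\<^sup>2 / (1 - ?x\<^sup>2)"
        using less by (simp add: le_divide_eq)
      with m cardA show False by linarith
    qed
  qed
  ultimately show ?thesis
    using power2_le_imp_le[of 1 ?x] by simp
qed

end

theorem theorem5p3:
  fixes G :: "'a pair_pre_digraph" and v0 :: 'a and k :: nat
  assumes "pointed_graph G v0"
    and "k \<in> radii G v0"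
  shows "bounded_operator_ell2 (radii G v0) (trans_op_dom G v0 k) (trans_op G v0 k) \<and>
    1 \<le> ell2_onorm (radii G v0) (trans_op G v0 k) \<and>
    ell2_onorm (radii G v0) (trans_op G v0 k) \<le> sqrt (c_const G v0 k * d_const G v0 k)"
proof -
  interpret pointed_graph G v0 by (rule assms(1))
  show ?thesis
    using bounded_trans_op ell2_onorm_trans_op_ge[OF assms(2)] ell2_onorm_trans_op_le by blast
qed

end
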